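(* Let $n\equiv 0\pmod 4$ be a positive integer, let $t=\frac{n-2}{2}$, and let $\mathbb{D}=(\{1,\ldots,n\},\mathcal{B})$ be an $\frac{n-2}{2}$-$(n,\frac n2,1)$ design. If $w\in \mathrm{GF}(2)^n$ has odd weight $h$ with $1\le h\le t$, then $\hat f_{\mathbb{D}}(w)=0$.
   Context: A $t$-$(n,k,\lambda)$ design, $1\le t\le k\le n$, is a pair $(\mathcal{P},\mathcal{B})$ where $\mathcal{P}=\{1,\ldots,n\}$ and $\mathcal{B}$ is a set of $k$-subsets (blocks) of $\mathcal{P}$ such that every $t$-subset of $\mathcal{P}$ is contained in exactly $\lambda$ blocks. The support of $x\in \mathrm{GF}(2)^n$ is $\{i: x_i=1\}$; the weight of $x$ is the cardinality of its support. The characteristic function $f_{\mathbb{D}}:\mathrm{GF}(2)^n\to\{0,1\}\subset\mathbb{R}$ has $f_{\mathbb{D}}(x)=1$ if and only if the support of $x$ is a block. The Walsh transform is $\hat f(w)=\sum_{x\in \mathrm{GF}(2)^n}f(x)(-1)^{w\cdot x}$, where $w\cdot x=\sum_i w_ix_i$. *)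

theory Defs
  imports Complex_Main "HOL-Library.Z2" "HOL-Library.FuncSet" "HOL-Number_Theory.Cong"
begin

definition is_design :: "nat \<Rightarrow> nat \<Rightarrow> nat \<Rightarrow> nat \<Rightarrow> nat set \<times> nat set set \<Rightarrow> bool" where
  "is_design t n k l D \<longleftrightarrow>
     1 \<le> t \<and> t \<le> k \<and> k \<le> n \<and>
     fst D = {1..n} \<and>
     (\<forall>B\<in>snd D. B \<subseteq> fst D \<and> card B = k) \<and>
     (\<forall>T. T \<subseteq> fst D \<and> card T = t \<longrightarrow> card {B \<in> snd D. T \<subseteq> B} = l)"

(* Coordinates are numbered from 1 to n. Vectors are extensional functions
   (undefined outside {1..n}), so that the set below has exactly 2 ^ n elements. *)
definition GF2_vecs :: "nat \<Rightarrow> (nat \<Rightarrow> bit) set" where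
  "GF2_vecs n = {1..n} \<rightarrow>\<^sub>E UNIV"

definition supp :: "nat \<Rightarrow> (nat \<Rightarrow> bit) \<Rightarrow> nat set" where
  "supp n x = {i \<in> {1..n}. x i = 1}"

definition weight :: "nat \<Rightarrow> (nat \<Rightarrow> bit) \<Rightarrow> nat" where
  "weight n x = card (supp n x)"

definition dot :: "nat \<Rightarrow> (nat \<Rightarrow> bit) \<Rightarrow> (nat \<Rightarrow> bit) \<Rightarrow> bit" where
  "dot n w x = (\<Sum>i\<in>{1..n}. w i * x i)"

definition char_fun :: "nat \<Rightarrow> nat set \<times> nat set set \<Rightarrow> (nat \<Rightarrow> bit) \<Rightarrow> real" where
  "char_fun n D x = (if supp n x \<in> snd D then 1 else 0)"

definition walsh :: "nat \<Rightarrow> ((nat \<Rightarrow> bit) \<Rightarrow> real) \<Rightarrow> (nat \<Rightarrow> bit) \<Rightarrow> real" where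
  "walsh n f w = (\<Sum>x\<in>GF2_vecs n. f x * (-1) ^ (of_bit (dot n w x) :: nat))"

end

theory Submission
  imports Defs
begin

text \<open>
  The blocks of a \<open>t\<close>-design look like the family of all \<open>k\<close>-subsets, up to a constant factor, to
  every statistic that depends on at most \<open>t\<close> points.  Indeed, a double count shows that every set
  \<open>U\<close> with at most \<open>t\<close> points lies in a number of blocks that is proportional, with a factor
  independent of \<open>U\<close>, to the number of \<open>k\<close>-subsets above \<open>U\<close>
  (\<open>design_blocks_over_proportional\<close>).  If \<open>W\<close> is the support of \<open>w\<close>, the sign
  \<open>(-1)\<^bsup>card (B \<inter> W)\<^esup>\<close> is a linear combination of the indicators of \<open>U \<subseteq> B\<close> for \<open>U \<subseteq> W\<close>, because it
  is the product of \<open>1 - 2 [i \<in> B]\<close> over \<open>i \<in> W\<close>.  As \<open>W\<close> has at most \<open>t\<close> points, the sum of these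
  signs over the blocks, which is the Walsh transform at \<open>w\<close>, is proportional to the sum over all
  \<open>k\<close>-subsets (\<open>design_sign_sum_proportional\<close>).

  That last sum vanishes: since the block size is \<open>k = n / 2\<close>, complementation permutes the
  \<open>k\<close>-subsets, and since \<open>W\<close> has odd size it reverses every sign.
\<close>

section \<open>Counting blocks above a small set\<close>

lemma card_subsets_between:
  assumes "finite B" "U \<subseteq> B" "card U \<le> t"
  shows "card {T. U \<subseteq> T \<and> T \<subseteq> B \<and> card T = t} = (card B - card U) choose (t - card U)"
proof -
  have fU: "finite U" using assms finite_subset by blast
  have "bij_betw (\<lambda>S. S \<union> U) {S. S \<subseteq> B - U \<and> card S = t - card U}
          {T. U \<subseteq> T \<and> T \<subseteq> B \<and> card T = t}"
  proof (rule bij_betw_byWitness[where f' = "\<lambda>T. T - U"])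
    show "(\<lambda>S. S \<union> U) ` {S. S \<subseteq> B - U \<and> card S = t - card U}
            \<subseteq> {T. U \<subseteq> T \<and> T \<subseteq> B \<and> card T = t}"
    proof clarsimp
      fix S assume S: "S \<subseteq> B - U" "card S = t - card U"
      then have "finite S" using assms(1) finite_subset by blast
      moreover have "S \<inter> U = {}" using S by blast
      ultimately have "card (S \<union> U) = t" using S fU assms(3) by (simp add: card_Un_disjoint)
      then show "S \<subseteq> B \<and> U \<subseteq> B \<and> card (S \<union> U) = t" using S assms(2) by blast
    qed
  qed (use fU in \<open>auto simp: card_Diff_subset\<close>)
  then have "card {T. U \<subseteq> T \<and> T \<subseteq> B \<and> card T = t} = card {S. S \<subseteq> B - U \<and> card S = t - card U}"
    by (simp add: bij_betw_same_card)
  also have "\<dots> = (card B - card U) choose (t - card U)"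
    using assms fU by (simp add: n_subsets card_Diff_subset)
  finally show ?thesis .
qed

text \<open>Both sides count the pairs \<open>(T, B)\<close> with \<open>U \<subseteq> T \<subseteq> B\<close>, \<open>card T = t\<close> and \<open>B \<in> \<B>\<close>.\<close>

lemma sum_card_blocks_over:
  assumes "finite P" and blocks: "\<And>B. B \<in> \<B> \<Longrightarrow> B \<subseteq> P \<and> card B = k"
    and "card U \<le> t"
  shows "(\<Sum>T | U \<subseteq> T \<and> T \<subseteq> P \<and> card T = t. card {B \<in> \<B>. T \<subseteq> B})
       = ((k - card U) choose (t - card U)) * card {B \<in> \<B>. U \<subseteq> B}"
proof -
  let ?TT = "{T. U \<subseteq> T \<and> T \<subseteq> P \<and> card T = t}"
  let ?BB = "{B \<in> \<B>. U \<subseteq> B}"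
  have finT: "finite ?TT" using assms(1) by (auto intro: finite_subset[of _ "Pow P"])
  have "?BB \<subseteq> Pow P" using blocks by auto
  then have finB: "finite ?BB" using assms(1) by (simp add: finite_subset)
  have "(\<Sum>T\<in>?TT. card {B \<in> \<B>. T \<subseteq> B}) = (\<Sum>T\<in>?TT. \<Sum>B | B \<in> ?BB \<and> T \<subseteq> B. 1)"
    by (intro sum.cong) (auto intro!: arg_cong[where f = card])
  also have "\<dots> = (\<Sum>B\<in>?BB. \<Sum>T | T \<in> ?TT \<and> T \<subseteq> B. 1)"
    using finT finB by (rule sum.swap_restrict)
  also have "\<dots> = (\<Sum>B\<in>?BB. (k - card U) choose (t - card U))"
  proof (rule sum.cong[OF refl])
    fix B assume B: "B \<in> ?BB"
    then have BP: "B \<subseteq> P" "card B = k" and UB: "U \<subseteq> B" using blocks by auto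
    have "{T. T \<in> ?TT \<and> T \<subseteq> B} = {T. U \<subseteq> T \<and> T \<subseteq> B \<and> card T = t}" using BP by auto
    then show "(\<Sum>T | T \<in> ?TT \<and> T \<subseteq> B. 1) = (k - card U) choose (t - card U)"
      using card_subsets_between[OF finite_subset[OF BP(1) assms(1)] UB assms(3)] BP(2) by simp
  qed
  finally show ?thesis by simp
qed

text \<open>
  The family of all \<open>k\<close>-subsets is itself a design, with \<open>(n - t) choose (k - t)\<close> blocks above each
  \<open>t\<close>-subset.  The double count relates the blocks above \<open>U\<close> to those above \<open>t\<close>-sets through factors
  that depend only on the size of \<open>U\<close>, so these factors are the same for both designs and cancel.
\<close>

lemma design_blocks_over_proportional:
  assumes D: "is_design t n k l ({1..n}, \<B>)"
    and U: "U \<subseteq> {1..n}" "card U \<le> t"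
  shows "((n - t) choose (k - t)) * card {B \<in> \<B>. U \<subseteq> B}
       = l * card {K. K \<subseteq> {1..n} \<and> card K = k \<and> U \<subseteq> K}"
proof -
  let ?TT = "{T. U \<subseteq> T \<and> T \<subseteq> {1..n} \<and> card T = t}"
  let ?KK = "{K. K \<subseteq> {1..n} \<and> card K = k}"
  let ?c = "(k - card U) choose (t - card U)"
  let ?l' = "(n - t) choose (k - t)"
  have tk: "t \<le> k" and blocks: "\<And>B. B \<in> \<B> \<Longrightarrow> B \<subseteq> {1..n} \<and> card B = k"
    and cov: "\<And>T. T \<subseteq> {1..n} \<Longrightarrow> card T = t \<Longrightarrow> card {B \<in> \<B>. T \<subseteq> B} = l"
    using D by (auto simp: is_design_def)
  have "card ?TT * l = (\<Sum>T\<in>?TT. card {B \<in> \<B>. T \<subseteq> B})"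
    using cov by simp
  also have "\<dots> = ?c * card {B \<in> \<B>. U \<subseteq> B}"
    using blocks U(2) by (intro sum_card_blocks_over) auto
  finally have b: "card ?TT * l = ?c * card {B \<in> \<B>. U \<subseteq> B}" .
  have cov': "card {K \<in> ?KK. T \<subseteq> K} = ?l'" if "T \<subseteq> {1..n}" "card T = t" for T
  proof -
    have "{K \<in> ?KK. T \<subseteq> K} = {K. T \<subseteq> K \<and> K \<subseteq> {1..n} \<and> card K = k}" by auto
    then show ?thesis using card_subsets_between[of "{1..n}" T k] that tk by simp
  qed
  have "card ?TT * ?l' = (\<Sum>T\<in>?TT. card {K \<in> ?KK. T \<subseteq> K})"
    using cov' by simp
  also have "\<dots> = ?c * card {K \<in> ?KK. U \<subseteq> K}"
    using U(2) by (intro sum_card_blocks_over) auto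
  finally have b': "card ?TT * ?l' = ?c * card {K \<in> ?KK. U \<subseteq> K}" .
  have "?c * (?l' * card {B \<in> \<B>. U \<subseteq> B}) = ?l' * (card ?TT * l)"
    unfolding b by (rule mult.left_commute)
  also have "\<dots> = l * (card ?TT * ?l')" by (simp only: ac_simps)
  also have "\<dots> = ?c * (l * card {K \<in> ?KK. U \<subseteq> K})"
    unfolding b' by (rule mult.left_commute)
  finally have "?c * (?l' * card {B \<in> \<B>. U \<subseteq> B}) = ?c * (l * card {K \<in> ?KK. U \<subseteq> K})" .
  moreover have "?c \<noteq> 0" using tk by simp
  ultimately have "?l' * card {B \<in> \<B>. U \<subseteq> B} = l * card {K \<in> ?KK. U \<subseteq> K}" by simp
  also have "{K \<in> ?KK. U \<subseteq> K} = {K. K \<subseteq> {1..n} \<and> card K = k \<and> U \<subseteq> K}" by auto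
  finally show ?thesis .
qed

section \<open>Sign sums\<close>

lemma sum_Pow_power_card:
  fixes a :: "'a :: comm_ring_1"
  assumes "finite A"
  shows "(\<Sum>U\<in>Pow A. a ^ card U) = (1 + a) ^ card A"
  using prod_add[OF assms, of "\<lambda>_. a" "\<lambda>_. 1"] by (simp add: add.commute)

text \<open>
  The coefficients come from expanding \<open>\<Prod>i\<in>W. 1 - 2 [i \<in> B]\<close>.  Only sets \<open>U \<subseteq> W\<close> occur, so
  when \<open>W\<close> has at most \<open>t\<close> points every block count on the right is determined by the parameters of
  a \<open>t\<close>-design.
\<close>

lemma sign_sum_expansion:
  assumes "finite \<B>" "finite W"
  shows "(\<Sum>B\<in>\<B>. (-1 :: real) ^ card (B \<inter> W))
       = (\<Sum>U\<in>Pow W. (-2) ^ card U * real (card {B \<in> \<B>. U \<subseteq> B}))"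
proof -
  have "(\<Sum>B\<in>\<B>. (-1 :: real) ^ card (B \<inter> W)) = (\<Sum>B\<in>\<B>. \<Sum>U | U \<in> Pow W \<and> U \<subseteq> B. (-2) ^ card U)"
  proof (rule sum.cong[OF refl])
    fix B
    have "{U. U \<in> Pow W \<and> U \<subseteq> B} = Pow (B \<inter> W)" by auto
    then show "(-1 :: real) ^ card (B \<inter> W) = (\<Sum>U | U \<in> Pow W \<and> U \<subseteq> B. (-2) ^ card U)"
      using sum_Pow_power_card[of "B \<inter> W" "-2 :: real"] assms(2) by simp
  qed
  also have "\<dots> = (\<Sum>U\<in>Pow W. \<Sum>B | B \<in> \<B> \<and> U \<subseteq> B. (-2) ^ card U)"
    using assms by (intro sum.swap_restrict) auto
  finally show ?thesis by (simp add: mult.commute)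
qed

lemma design_sign_sum_proportional:
  assumes D: "is_design t n k l ({1..n}, \<B>)"
    and W: "W \<subseteq> {1..n}" "card W \<le> t"
  shows "real ((n - t) choose (k - t)) * (\<Sum>B\<in>\<B>. (-1) ^ card (B \<inter> W))
       = real l * (\<Sum>K | K \<subseteq> {1..n} \<and> card K = k. (-1) ^ card (K \<inter> W))"
proof -
  let ?KK = "{K. K \<subseteq> {1..n} \<and> card K = k}"
  let ?l' = "(n - t) choose (k - t)"
  have fW: "finite W" using W(1) finite_subset by blast
  have "\<B> \<subseteq> Pow {1..n}" using D by (auto simp: is_design_def)
  then have fB: "finite \<B>" using finite_subset by blast
  have fK: "finite ?KK" by (auto intro: finite_subset[of _ "Pow {1..n}"])
  have "real ?l' * real (card {B \<in> \<B>. U \<subseteq> B}) = real l * real (card {K \<in> ?KK. U \<subseteq> K})"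
    if "U \<in> Pow W" for U
  proof -
    have "U \<subseteq> {1..n}" "card U \<le> t"
      using that W card_mono[OF fW, of U] by auto
    from design_blocks_over_proportional[OF D this] show ?thesis
      unfolding of_nat_mult[symmetric] by (simp)
  qed
  then show ?thesis
    unfolding sign_sum_expansion[OF fB fW] sign_sum_expansion[OF fK fW] sum_distrib_left
    by (intro sum.cong) (simp_all add: mult.left_commute)
qed

text \<open>
  The two parts of \<open>W\<close> inside and outside \<open>K\<close> have sizes of different parity, so the terms of \<open>K\<close> and
  of its complement cancel.
\<close>

lemma sign_sum_half_subsets_eq_0:
  assumes P: "finite P" "card P = 2 * k" and W: "W \<subseteq> P" "odd (card W)"
  shows "(\<Sum>K | K \<subseteq> P \<and> card K = k. (-1 :: real) ^ card (K \<inter> W)) = 0" (is "?S = 0")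
proof -
  let ?KK = "{K. K \<subseteq> P \<and> card K = k}"
  have compl: "P - K \<in> ?KK" if "K \<in> ?KK" for K
    using that P card_Diff_subset[of K P] finite_subset by auto
  have "?S = (\<Sum>K\<in>?KK. (-1) ^ card ((P - K) \<inter> W))"
    using compl by (intro sum.reindex_bij_witness[where i = "\<lambda>K. P - K" and j = "\<lambda>K. P - K"])
      (auto simp: double_diff)
  also have "\<dots> = (\<Sum>K\<in>?KK. - ((-1) ^ card (K \<inter> W)))"
  proof (rule sum.cong[OF refl])
    fix K
    have fW: "finite W" using P W finite_subset by blast
    have "card W = card (K \<inter> W) + card ((P - K) \<inter> W)"
      using fW W(1) by (subst card_Un_disjoint[symmetric]) (auto intro!: arg_cong[where f = card])
    then have "even (card ((P - K) \<inter> W)) \<longleftrightarrow> odd (card (K \<inter> W))" using W(2) by presburger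
    then show "(-1 :: real) ^ card ((P - K) \<inter> W) = - ((-1) ^ card (K \<inter> W))"
      by (simp add: uminus_power_if)
  qed
  also have "\<dots> = - ?S" by (simp add: sum_negf)
  finally show ?thesis by simp
qed

section \<open>The Walsh transform as a sign sum over blocks\<close>

lemma bij_betw_supp: "bij_betw (supp n) (GF2_vecs n) (Pow {1..n})"
proof (rule bij_betw_byWitness[where
      f' = "\<lambda>A i. if i \<in> {1..n} then (if i \<in> A then 1 else 0) else undefined"])
  show "\<forall>x\<in>GF2_vecs n. (\<lambda>i. if i \<in> {1..n} then if i \<in> supp n x then 1 else 0 else undefined) = x"
    by (auto simp: GF2_vecs_def supp_def fun_eq_iff PiE_def extensional_def)
qed (auto simp: GF2_vecs_def supp_def PiE_def extensional_def)

lemma minus_one_power_of_bit_of_nat: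
  "(-1 :: real) ^ (of_bit (of_nat m :: bit) :: nat) = (-1) ^ m"
  by (cases "even m") (auto elim!: evenE oddE)

lemma minus_one_power_dot:
  "(-1 :: real) ^ (of_bit (dot n w x) :: nat) = (-1) ^ card (supp n x \<inter> supp n w)"
proof -
  have "dot n w x = (\<Sum>i\<in>{1..n}. if i \<in> supp n x \<inter> supp n w then 1 else 0)"
    unfolding dot_def by (intro sum.cong) (auto simp: supp_def)
  also have "\<dots> = of_nat (card ({1..n} \<inter> (supp n x \<inter> supp n w)))"
    by (subst sum.inter_restrict[symmetric]) simp_all
  also have "{1..n} \<inter> (supp n x \<inter> supp n w) = supp n x \<inter> supp n w"
    by (auto simp: supp_def)
  finally show ?thesis by (simp only: minus_one_power_of_bit_of_nat)
qed

lemma walsh_char_fun: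
  assumes "\<B> \<subseteq> Pow {1..n}"
  shows "walsh n (char_fun n (P, \<B>)) w = (\<Sum>B\<in>\<B>. (-1) ^ card (B \<inter> supp n w))"
proof -
  have "walsh n (char_fun n (P, \<B>)) w
      = (\<Sum>x\<in>GF2_vecs n. (if supp n x \<in> \<B> then 1 else 0) * (-1) ^ card (supp n x \<inter> supp n w))"
    unfolding walsh_def char_fun_def minus_one_power_dot by simp
  also have "\<dots> = (\<Sum>A\<in>Pow {1..n}. (if A \<in> \<B> then 1 else 0) * (-1) ^ card (A \<inter> supp n w))"
    by (rule sum.reindex_bij_betw[OF bij_betw_supp])
  also have "\<dots> = (\<Sum>B\<in>\<B>. (-1) ^ card (B \<inter> supp n w))"
    using assms by (intro sum.mono_neutral_cong_right) auto
  finally show ?thesis .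
qed

section \<open>Vanishing at odd weights\<close>

theorem theorem30:
  fixes n t h :: nat and \<B> :: "nat set set" and w :: "nat \<Rightarrow> bit"
  assumes "n > 0" and "[n = 0] (mod 4)"
    and "t = (n - 2) div 2"
    and "is_design t n (n div 2) 1 ({1..n}, \<B>)"
    and "w \<in> GF2_vecs n"
    and "weight n w = h" and "odd h" and "1 \<le> h" and "h \<le> t"
  shows "walsh n (char_fun n ({1..n}, \<B>)) w = 0"
proof -
  let ?W = "supp n w" and ?k = "n div 2"
  have n: "n = 2 * ?k" using assms(2) by (auto simp: cong_0_iff)
  have W: "?W \<subseteq> {1..n}" "card ?W \<le> t" "odd (card ?W)"
    using assms by (auto simp: supp_def weight_def)
  have "(\<Sum>K | K \<subseteq> {1..n} \<and> card K = ?k. (-1 :: real) ^ card (K \<inter> ?W)) = 0"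
    using n W by (intro sign_sum_half_subsets_eq_0) auto
  with design_sign_sum_proportional[OF assms(4) W(1,2)]
  have "real ((n - t) choose (?k - t)) * (\<Sum>B\<in>\<B>. (-1) ^ card (B \<inter> ?W)) = 0" by simp
  moreover have "(n - t) choose (?k - t) \<noteq> 0" by simp
  ultimately have "(\<Sum>B\<in>\<B>. (-1 :: real) ^ card (B \<inter> ?W)) = 0" by simp
  moreover have "\<B> \<subseteq> Pow {1..n}" using assms(4) by (auto simp: is_design_def)
  ultimately show ?thesis by (simp add: walsh_char_fun)
qed

end
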